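(* Let $n,k>0$ and let $c=(1,2,\dots,n)\in\mathfrak{S}_n$ be the long cycle. For every $\pi\in NC(n,k,0)$, in the $\mathfrak{S}_n$-module $V(n,k,0)$ we have $$c.\pi=(-1)^{n+1}r(\pi),$$ where $r:NC(n,k,0)\to NC(n,k,0)$ is clockwise rotation, $r(\pi)=c(\pi)$ (replace each index $i$ by $i+1$, with $n$ replaced by $1$).
   Context: $[n]=\{1,\dots,n\}$, $s_i=(i,i+1)\in\mathfrak{S}_n$. For $w\in\mathfrak{S}_n$ and a set partition $\pi$ of $[n]$, $w(\pi)$ is the set partition in which $w(a),w(b)$ share a block iff $a,b$ share a block of $\pi$; $B_i(\pi)$ is the block of $\pi$ containing $i$. A set partition is noncrossing if whenever $a<b<c<d$ with $a,c$ in one block and $b,d$ in one block, all four are in the same block. $NC(n)$ is the set of noncrossing partitions of $[n]$; $NC(n,k,s)$ those with exactly $k$ blocks of which exactly $s$ are singletons. A set partition $\pi$ is almost noncrossing if it is not noncrossing but $s_i(\pi)$ is noncrossing for some $i$; then $\pi$ crosses at $i$. Skein map: for $\pi$ almost noncrossing crossing at $i$, write $B_i(\pi)=\{i,a_1,\dots,a_k\}$, $B_{i+1}(\pi)=\{i+1,b_1,\dots,b_\ell\}$ ($k,\ell\ge1$); let $\pi_1=s_i(\pi)$ and let $\pi_2,\pi_3,\pi_4$ be obtained from $\pi$ by replacing $B_i(\pi),B_{i+1}(\pi)$ by $\{i,i+1\},\{a_1..a_k,b_1..b_\ell\}$ (for $\pi_2$), $\{i,i+1,a_1..a_k\},\{b_1..b_\ell\}$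 (for $\pi_3$), $\{i,i+1,b_1..b_\ell\},\{a_1..a_k\}$ (for $\pi_4$). Then $\sigma(\pi)=\pi_1+\pi_2-\pi_3-\pi_4$ if $k,\ell\ge2$, with the $\pi_3$ term deleted if $\ell=1$ and the $\pi_4$ term deleted if $k=1$; this is independent of the chosen crossing index. $V(n)$ is the $\mathbb{Q}$-vector space with basis $NC(n)$ and $V(n,k,s)$ the subspace with basis $NC(n,k,s)$. For $1\le i\le n-1$, $\tau_i$ is the linear operator on $V(n)$ defined on $\pi\in NC(n)$ by: $\tau_i(\pi)=s_i(\pi)$ if $s_i(\pi)$ is noncrossing and $B_i(\pi)\ne B_{i+1}(\pi)$; $\tau_i(\pi)=-\pi$ if $B_i(\pi)=B_{i+1}(\pi)$; $\tau_i(\pi)=\sigma(s_i(\pi))$ otherwise. The assignment $s_i\mapsto\tau_i$ defines an action $w.v$ of $\mathfrak{S}_n$ on $V(n)$, for which $V(n,k,s)$ is a submodule. *)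

theory Defs
  imports
    Complex_Main
    "HOL-Library.Disjoint_Sets"
    "HOL-Library.Poly_Mapping"
    "HOL-Algebra.Group_Action"
    "HOL-Algebra.Sym_Groups"
begin

section \<open>Noncrossing partitions\<close>

type_synonym set_partition = "nat set set"

definition noncrossing :: "set_partition \<Rightarrow> bool" where
  "noncrossing \<pi> \<longleftrightarrow>
     (\<forall>a b c d. a < b \<longrightarrow> b < c \<longrightarrow> c < d \<longrightarrow>
        (\<exists>B\<in>\<pi>. a \<in> B \<and> c \<in> B) \<longrightarrow> (\<exists>B\<in>\<pi>. b \<in> B \<and> d \<in> B) \<longrightarrow>
        (\<exists>B\<in>\<pi>. a \<in> B \<and> b \<in> B \<and> c \<in> B \<and> d \<in> B))"

definition NC :: "nat \<Rightarrow> set_partition set" where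
  "NC n = {\<pi>. partition_on {1..n} \<pi> \<and> noncrossing \<pi>}"

definition NCks :: "nat \<Rightarrow> nat \<Rightarrow> nat \<Rightarrow> set_partition set" where
  "NCks n k s = {\<pi> \<in> NC n. card \<pi> = k \<and> card {B \<in> \<pi>. card B = 1} = s}"

definition perm_image :: "(nat \<Rightarrow> nat) \<Rightarrow> set_partition \<Rightarrow> set_partition" where
  "perm_image w \<pi> = (\<lambda>B. w ` B) ` \<pi>"

definition adj :: "nat \<Rightarrow> nat \<Rightarrow> nat" where
  "adj i = Transposition.transpose i (Suc i)"

definition block :: "nat \<Rightarrow> set_partition \<Rightarrow> nat set" where
  "block i \<pi> = (THE B. B \<in> \<pi> \<and> i \<in> B)"

definition long_cycle :: "nat \<Rightarrow> nat \<Rightarrow> nat" where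
  "long_cycle n = cycle_of_list [1..<Suc n]"

definition rotation :: "nat \<Rightarrow> set_partition \<Rightarrow> set_partition" where
  "rotation n \<pi> = perm_image (long_cycle n) \<pi>"


section \<open>The vector space \<open>V(n)\<close>\<close>

text \<open>All the spaces \<open>V(n)\<close> live in the free rational vector space on all sets of
  sets of natural numbers.\<close>

type_synonym partition_vec = "set_partition \<Rightarrow>\<^sub>0 rat"

definition basis_vec :: "set_partition \<Rightarrow> partition_vec" where
  "basis_vec \<pi> = Poly_Mapping.single \<pi> 1"

definition scale :: "rat \<Rightarrow> partition_vec \<Rightarrow> partition_vec" where
  "scale q v = Poly_Mapping.map ((*) q) v"

lemma lookup_scale [simp]: "Poly_Mapping.lookup (scale q v) \<pi> = q * Poly_Mapping.lookup v \<pi>"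
  by (simp add: scale_def Poly_Mapping.map.rep_eq when_def)

lemma vector_space_scale: "vector_space scale"
  by unfold_locales (auto intro!: poly_mapping_eqI simp: lookup_add algebra_simps)

definition V :: "nat \<Rightarrow> partition_vec set" where
  "V n = {v. Poly_Mapping.keys v \<subseteq> NC n}"


section \<open>The skein action\<close>

text \<open>\<open>skein i \<pi>\<close> is \<open>\<sigma>(\<pi>)\<close> computed at the crossing index \<open>i\<close>. It is meaningful when \<open>\<pi>\<close> is
  not noncrossing but \<open>s\<^sub>i(\<pi>)\<close> is.\<close>

definition skein :: "nat \<Rightarrow> set_partition \<Rightarrow> partition_vec" where
  "skein i \<pi> =
     (let A = block i \<pi> - {i};
          B = block (Suc i) \<pi> - {Suc i};
          R = \<pi> - {block i \<pi>, block (Suc i) \<pi>};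
          \<pi>1 = perm_image (adj i) \<pi>;
          \<pi>2 = R \<union> {{i, Suc i}, A \<union> B};
          \<pi>3 = R \<union> {{i, Suc i} \<union> A, B};
          \<pi>4 = R \<union> {{i, Suc i} \<union> B, A}
      in basis_vec \<pi>1 + basis_vec \<pi>2
         - (if card B = 1 then 0 else basis_vec \<pi>3)
         - (if card A = 1 then 0 else basis_vec \<pi>4))"

text \<open>In the last case below, \<open>s\<^sub>i(\<pi>)\<close> is not noncrossing while \<open>s\<^sub>i(s\<^sub>i(\<pi>)) = \<pi>\<close> is, so
  \<open>s\<^sub>i(\<pi>)\<close> is almost noncrossing and crosses at \<open>i\<close>.\<close>

definition tau_basis :: "nat \<Rightarrow> set_partition \<Rightarrow> partition_vec" where
  "tau_basis i \<pi> =
     (if noncrossing (perm_image (adj i) \<pi>) \<and> block i \<pi> \<noteq> block (Suc i) \<pi>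
        then basis_vec (perm_image (adj i) \<pi>)
      else if block i \<pi> = block (Suc i) \<pi> then - basis_vec \<pi>
      else skein i (perm_image (adj i) \<pi>))"

definition tau :: "nat \<Rightarrow> partition_vec \<Rightarrow> partition_vec" where
  "tau i v = (\<Sum>\<pi>\<in>Poly_Mapping.keys v. scale (Poly_Mapping.lookup v \<pi>) (tau_basis i \<pi>))"

text \<open>\<open>skein_action n \<rho>\<close> says that \<open>\<rho>\<close> is the linear left action of \<open>\<SS>\<^sub>n\<close> on \<open>V(n)\<close> in which
  \<open>s\<^sub>i\<close> acts as \<open>\<tau>\<^sub>i\<close>. As the \<open>s\<^sub>i\<close> generate the group, this determines \<open>\<rho>\<close> on
  \<open>\<SS>\<^sub>n \<times> V(n)\<close>. Products in \<^const>\<open>sym_group\<close> are composed right to left.\<close>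

definition skein_action :: "nat \<Rightarrow> ((nat \<Rightarrow> nat) \<Rightarrow> partition_vec \<Rightarrow> partition_vec) \<Rightarrow> bool" where
  "skein_action n \<rho> \<longleftrightarrow>
     group_action (sym_group n) (V n) \<rho> \<and>
     (\<forall>w \<in> carrier (sym_group n). \<forall>u \<in> V n. \<forall>v \<in> V n. \<rho> w (u + v) = \<rho> w u + \<rho> w v) \<and>
     (\<forall>w \<in> carrier (sym_group n). \<forall>q. \<forall>v \<in> V n. \<rho> w (scale q v) = scale q (\<rho> w v)) \<and>
     (\<forall>i \<in> {1..<n}. \<forall>v \<in> V n. \<rho> (adj i) v = tau i v)"


section \<open>Rotation preserves the noncrossing partitions\<close>

lemma long_cycle_permutes: "long_cycle n permutes {1..n}"
  using cycle_permutes[of "[1..<Suc n]"] by (simp add: long_cycle_def atLeastLessThanSuc_atLeastAtMost del: upt_Suc)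

lemma long_cycle_apply:
  assumes "i \<in> {1..n}"
  shows "long_cycle n i = (if i = n then 1 else Suc i)"
proof -
  let ?xs = "[1..<Suc n]"
  have "map (long_cycle n) ?xs = rotate1 ?xs"
    using cyclic_rotation[of ?xs 1] by (simp add: long_cycle_def del: upt_Suc)
  hence "map (long_cycle n) ?xs ! (i - 1) = rotate1 ?xs ! (i - 1)" by simp
  thus ?thesis using assms
    by (auto simp: nth_rotate1 mod_Suc simp del: upt_Suc)
qed

lemma perm_image_shares:
  assumes "w permutes S"
  shows "(\<exists>B\<in>perm_image w \<pi>. \<forall>x\<in>X. w x \<in> B) \<longleftrightarrow> (\<exists>B\<in>\<pi>. X \<subseteq> B)"
  using permutes_inj[OF assms] by (auto simp: perm_image_def inj_image_mem_iff subset_eq)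

lemma partition_on_perm_image:
  assumes "w permutes S" "partition_on S \<pi>"
  shows "partition_on S (perm_image w \<pi>)"
proof (rule partition_onI)
  show "\<Union> (perm_image w \<pi>) = S"
    using partition_onD1[OF assms(2)] permutes_image[OF assms(1)]
    by (auto simp: perm_image_def simp flip: image_Union)
  show "disjnt p q" if pq: "p \<in> perm_image w \<pi>" "q \<in> perm_image w \<pi>" "p \<noteq> q" for p q
  proof -
    obtain P Q where PQ: "P \<in> \<pi>" "Q \<in> \<pi>" "p = w ` P" "q = w ` Q"
      using pq by (auto simp: perm_image_def)
    hence "P \<inter> Q = {}"
      using pq(3) partition_onD2[OF assms(2)] by (auto dest: disjointD)
    thus ?thesis
      using PQ image_Int[OF permutes_inj[OF assms(1)], of P Q] by (simp add: disjnt_def)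
  qed
  show "{} \<notin> perm_image w \<pi>"
    using partition_onD3[OF assms(2)] by (auto simp: perm_image_def)
qed

lemma noncrossing_rotation:
  assumes "\<pi> \<in> NC n"
  shows "noncrossing (rotation n \<pi>)"
  unfolding noncrossing_def
proof (intro allI impI)
  let ?c = "long_cycle n"
  have nc: "\<exists>B\<in>\<pi>. {a, b, c, d} \<subseteq> B"
    if "a < b" "b < c" "c < d" "\<exists>B\<in>\<pi>. {a, c} \<subseteq> B" "\<exists>B\<in>\<pi>. {b, d} \<subseteq> B" for a b c d
    using assms that unfolding NC_def noncrossing_def by simp
  have part: "partition_on {1..n} (rotation n \<pi>)"
    using assms long_cycle_permutes partition_on_perm_image
    by (auto simp: NC_def rotation_def)
  note shares = perm_image_shares[OF long_cycle_permutes, of n \<pi>, folded rotation_def]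
  fix a b c d :: nat
  assume less: "a < b" "b < c" "c < d"
    and ac: "\<exists>B\<in>rotation n \<pi>. a \<in> B \<and> c \<in> B" and bd: "\<exists>B\<in>rotation n \<pi>. b \<in> B \<and> d \<in> B"
  have mem: "a \<in> {1..n}" "d \<in> {1..n}"
    using ac bd partition_onD1[OF part] by auto
  have shift: "?c (x - 1) = x" if "a < x" "x \<le> d" for x
    using that mem by (subst long_cycle_apply) auto
  show "\<exists>B\<in>rotation n \<pi>. a \<in> B \<and> b \<in> B \<and> c \<in> B \<and> d \<in> B"
  proof (cases "a = 1")
    case True
    have n: "?c n = a" using mem True by (subst long_cycle_apply) auto
    have "\<exists>B\<in>\<pi>. {b - 1, d - 1} \<subseteq> B" using bd shares[of "{b - 1, d - 1}"] less shift by simp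
    moreover have "\<exists>B\<in>\<pi>. {c - 1, n} \<subseteq> B"
      using ac shares[of "{c - 1, n}"] less shift n by (simp add: conj_commute)
    ultimately have "\<exists>B\<in>\<pi>. {b - 1, c - 1, d - 1, n} \<subseteq> B"
      using less mem True by (intro nc) simp_all
    thus ?thesis using shares[of "{b - 1, c - 1, d - 1, n}"] less shift n
      by (auto)
  next
    case False
    have a: "?c (a - 1) = a" using mem False by (subst long_cycle_apply) auto
    have "\<exists>B\<in>\<pi>. {a - 1, c - 1} \<subseteq> B" using ac shares[of "{a - 1, c - 1}"] less shift a by simp
    moreover have "\<exists>B\<in>\<pi>. {b - 1, d - 1} \<subseteq> B"
      using bd shares[of "{b - 1, d - 1}"] less shift by simp
    ultimately have "\<exists>B\<in>\<pi>. {a - 1, b - 1, c - 1, d - 1} \<subseteq> B"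
      using less mem False by (intro nc) simp_all
    thus ?thesis using shares[of "{a - 1, b - 1, c - 1, d - 1}"] less shift a
      by (auto)
  qed
qed

lemma rotation_in_NCks:
  assumes "\<pi> \<in> NCks n k s"
  shows "rotation n \<pi> \<in> NCks n k s"
proof -
  let ?f = "\<lambda>B. long_cycle n ` B"
  have nc: "\<pi> \<in> NC n" using assms by (simp add: NCks_def)
  have inj: "inj (long_cycle n)" by (rule permutes_inj[OF long_cycle_permutes])
  have inj': "inj_on ?f X" for X
    using inj by (auto simp: inj_on_def inj_image_eq_iff)
  have card: "card (?f B) = card B" for B
    using inj by (meson card_image inj_on_subset subset_UNIV)
  have "{B \<in> rotation n \<pi>. card B = 1} = ?f ` {B \<in> \<pi>. card B = 1}"
    using card by (auto simp: rotation_def perm_image_def)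
  hence "card {B \<in> rotation n \<pi>. card B = 1} = card {B \<in> \<pi>. card B = 1}"
    using card_image[OF inj'] by simp
  moreover have "card (rotation n \<pi>) = card \<pi>"
    unfolding rotation_def perm_image_def by (rule card_image[OF inj'])
  moreover have "rotation n \<pi> \<in> NC n"
    using nc noncrossing_rotation[OF nc] partition_on_perm_image[OF long_cycle_permutes]
    by (auto simp: NC_def rotation_def)
  ultimately show ?thesis using assms by (simp add: NCks_def)
qed

end

theory Submission
  imports Defs "Jordan_Normal_Form.Determinant"
begin

text \<open>The long cycle is \<open>s\<^sub>1 \<cdots> s\<^bsub>n-1\<^esub>\<close>, so it suffices to find enough linear functionals on
  \<open>V(n,k,0)\<close> on which each \<open>\<tau>\<^sub>i\<close> acts as \<open>-s\<^sub>i\<close>. For \<open>k\<close>-tuples \<open>f\<close> and \<open>g\<close> with disjoint ranges put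
  \<open>F\<^bsub>f,g\<^esub>(\<pi>) = det(M\<^sub>f) det(M\<^sub>g)\<close>, where \<open>M\<^sub>f\<close> is the incidence matrix of the blocks of \<open>\<pi>\<close> with the
  entries of \<open>f\<close>. This makes sense for every set partition with \<open>k\<close> blocks and is invariant
  under permuting \<open>f\<close>, \<open>g\<close> and \<open>\<pi>\<close> simultaneously. It vanishes if \<open>\<pi>\<close> has a singleton, and since
  determinants are alternating and additive in the blocks, it satisfies the skein relation up
  to sign: \<open>F(\<pi>) + F(\<pi>\<^sub>1) + F(\<pi>\<^sub>2) - F(\<pi>\<^sub>3) - F(\<pi>\<^sub>4) = 0\<close>.

  These functionals separate the points of \<open>V(n,k,0)\<close>. If \<open>f\<close> and \<open>g\<close> list the minima and the maxima
  of the blocks of \<open>\<pi>\<close>, then \<open>F\<^bsub>f,g\<^esub>(\<pi>) = 1\<close>, while \<open>F\<^bsub>f,g\<^esub>(\<pi>') \<noteq> 0\<close> forces the sum over the blocks of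
  maximum minus minimum to be strictly larger for \<open>\<pi>'\<close> than for \<open>\<pi>\<close>, unless \<open>\<pi>'\<close> has the same minima and
  maxima; and a noncrossing partition is determined by its sets of minima and maxima.\<close>

subsection \<open>Determinants of transversals\<close>

text \<open>The order of the list affects only a sign, which cancels in
  \<open>incidence_det Bs f * incidence_det Bs g\<close>.\<close>

definition incidence_det :: "nat set list \<Rightarrow> (nat \<Rightarrow> nat) \<Rightarrow> rat" where
  "incidence_det Bs f = det (mat (length Bs) (length Bs) (\<lambda>(t, s). of_bool (f s \<in> Bs ! t)))"

text \<open>Equal to \<open>\<plusminus>1\<close> if \<open>f\<close> and \<open>g\<close> are both transversals of the \<open>k\<close> blocks of \<open>\<pi>\<close>, and to \<open>0\<close> otherwise.
  Unlike the product of two incidence determinants, this form needs no enumeration of the blocks.\<close>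

definition transversal_det :: "nat \<Rightarrow> (nat \<Rightarrow> nat) \<Rightarrow> (nat \<Rightarrow> nat) \<Rightarrow> set_partition \<Rightarrow> rat" where
  "transversal_det k f g \<pi> = det (mat k k (\<lambda>(s, t). of_bool (\<exists>B\<in>\<pi>. f s \<in> B \<and> g t \<in> B)))"

lemma incidence_det_swap: "incidence_det (Y # X # Bs) f = - incidence_det (X # Y # Bs) f"
proof -
  let ?M = "\<lambda>Cs. mat (length Cs) (length Cs) (\<lambda>(t, s). of_bool (f s \<in> Cs ! t)) :: rat mat"
  have "?M (Y # X # Bs) = swaprows 0 1 (?M (X # Y # Bs))"
    by (rule eq_matI) (auto simp: nth_Cons split: nat.splits)
  thus ?thesis
    using det_swaprows[of 0 "length (X # Y # Bs)" 1 "?M (X # Y # Bs)"]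
    by (simp add: incidence_det_def)
qed

lemma incidence_det_Un:
  assumes "X \<inter> Y = {}"
  shows "incidence_det ((X \<union> Y) # Bs) f = incidence_det (X # Bs) f + incidence_det (Y # Bs) f"
proof -
  let ?k = "Suc (length Bs)"
  let ?r = "\<lambda>B. vec ?k (\<lambda>s. of_bool (f s \<in> B)) :: rat vec"
  have mat: "mat ?k ?k (\<lambda>(t, s). of_bool (f s \<in> (B # Bs) ! t)) =
      mat\<^sub>r ?k ?k (\<lambda>t. if t = 0 then ?r B else ?r (Bs ! (t - 1)))" for B
    by (rule eq_matI) (auto simp: nth_Cons split: nat.splits)
  have rows: "incidence_det (B # Bs) f =
      det (mat\<^sub>r ?k ?k (\<lambda>t. if t = 0 then ?r B else ?r (Bs ! (t - 1))))" for B
    by (simp add: incidence_det_def mat)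
  have Un: "?r (X \<union> Y) = ?r X + ?r Y"
    using assms by (intro eq_vecI) auto
  show ?thesis
    using det_row_add[of "\<lambda>_. ?r X" 0 ?k "\<lambda>_. ?r Y" "\<lambda>t. ?r (Bs ! (t - 1))"]
    unfolding rows Un by simp
qed

lemma incidence_det_avoid:
  assumes "\<And>s. s < Suc (length Bs) \<Longrightarrow> f s \<notin> X"
  shows "incidence_det (X # Bs) f = 0"
proof -
  have "incidence_det (X # Bs) f = incidence_det ({} # Bs) f"
    unfolding incidence_det_def
    by (rule arg_cong[of _ _ det], rule eq_matI) (auto simp: nth_Cons assms split: nat.splits)
  \<comment> \<open>Additivity for \<open>{} = {} \<union> {}\<close> makes the determinant equal to
    twice itself.\<close>
  thus ?thesis using incidence_det_Un[of "{}" "{}" Bs f] by simp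
qed

text \<open>Entry \<open>(s, t)\<close> of the product of the transposed incidence matrix of
  \<open>f\<close> with that of \<open>g\<close> counts the blocks containing both
  \<open>f s\<close> and \<open>g t\<close>. Disjointness bounds this count by 1, so it is the
  indicator in \<open>transversal_det\<close>.\<close>

lemma transversal_det_eq:
  assumes "distinct Bs" "set Bs = \<pi>" "disjoint \<pi>"
  shows "transversal_det (length Bs) f g \<pi> = incidence_det Bs f * incidence_det Bs g"
proof -
  let ?k = "length Bs"
  let ?M = "\<lambda>f. mat ?k ?k (\<lambda>(t, s). of_bool (f s \<in> Bs ! t)) :: rat mat"
  have entry: "of_bool (\<exists>B\<in>\<pi>. x \<in> B \<and> y \<in> B) =
      (\<Sum>t<?k. of_bool (x \<in> Bs ! t) * of_bool (y \<in> Bs ! t) :: rat)" for x y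
  proof (cases "\<exists>B\<in>\<pi>. x \<in> B \<and> y \<in> B")
    case True
    then obtain t where t: "t < ?k" "x \<in> Bs ! t" "y \<in> Bs ! t"
      using assms(2) by (auto simp: in_set_conv_nth)
    have uniq: "u = t" if "u < ?k" "x \<in> Bs ! u" for u
      using that t assms by (metis disjointD disjoint_iff nth_eq_iff_index_eq nth_mem)
    have "of_bool (x \<in> Bs ! u) * of_bool (y \<in> Bs ! u) = (if u = t then 1 else 0 :: rat)"
      if "u < ?k" for u
      using uniq[OF that] t by (cases "u = t") auto
    hence "(\<Sum>u<?k. of_bool (x \<in> Bs ! u) * of_bool (y \<in> Bs ! u) :: rat) =
        (\<Sum>u<?k. if u = t then 1 else 0)"
      by simp
    thus ?thesis using True t(1) by simp
  next
    case False
    thus ?thesis using assms(2) by (auto intro!: sum.neutral[symmetric])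
  qed
  have "mat ?k ?k (\<lambda>(s, t). of_bool (\<exists>B\<in>\<pi>. f s \<in> B \<and> g t \<in> B)) =
      transpose_mat (?M f) * ?M g"
    by (rule eq_matI) (auto simp: scalar_prod_def entry lessThan_atLeast0)
  thus ?thesis
    unfolding transversal_det_def incidence_det_def
    by (simp add: det_mult[of _ ?k] det_transpose[of _ ?k])
qed

text \<open>The incidence determinant is alternating and additive in the two distinguished blocks,
  so all five values expand into products of the six minors on the rows \<open>{i}\<close>,
  \<open>{j}\<close>, \<open>A\<close>, \<open>B\<close>. With the given signs, the only products
  left have \<open>i\<close> in both factors or \<open>j\<close> in both; these vanish because no
  point is hit by both \<open>f\<close> and \<open>g\<close>.\<close>

lemma five_term_relation:
  fixes f g :: "nat \<Rightarrow> nat"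
  assumes fg: "\<And>s t. s < k \<Longrightarrow> t < k \<Longrightarrow> f s \<noteq> g t"
    and R: "finite R" "disjoint R" "{} \<notin> R" "k = card R + 2"
    and AB: "A \<noteq> {}" "B \<noteq> {}" "A \<inter> B = {}" "i \<notin> A \<union> B" "j \<notin> A \<union> B" "i \<noteq> j"
    and disj: "(A \<union> B \<union> {i, j}) \<inter> \<Union>R = {}"
  defines "F \<equiv> (\<lambda>C D. transversal_det k f g (R \<union> {C, D}))"
  shows "F (insert i A) (insert j B) + F (insert j A) (insert i B) + F {i, j} (A \<union> B)
    - F ({i, j} \<union> A) B - F ({i, j} \<union> B) A = 0"
proof -
  obtain Rs where Rs: "set Rs = R" "distinct Rs"
    using finite_distinct_list[OF R(1)] by blast
  have len: "length Rs = card R" using Rs distinct_card by fastforce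
  define D where "D = (\<lambda>h X Y. incidence_det (X # Y # Rs) h)"
  have F: "F X Y = D f X Y * D g X Y"
    if "X \<noteq> {}" "Y \<noteq> {}" "X \<inter> Y = {}" "X \<union> Y \<subseteq> A \<union> B \<union> {i, j}" for X Y
  proof -
    have avoid: "X \<inter> C = {}" "Y \<inter> C = {}" if "C \<in> R" for C
      using disj that \<open>X \<union> Y \<subseteq> _\<close> by blast+
    hence "X \<notin> R" "Y \<notin> R" "X \<noteq> Y" using that by (metis Int_absorb)+
    hence "distinct (X # Y # Rs)" "length (X # Y # Rs) = k" "set (X # Y # Rs) = R \<union> {X, Y}"
      using Rs R(4) len by auto
    moreover have "disjoint (R \<union> {X, Y})"
      using R(2) avoid that by (auto simp: disjoint_def Int_commute)
    ultimately show ?thesis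
      unfolding F_def D_def using transversal_det_eq by metis
  qed
  have swap: "D h Y X = - D h X Y" for h X Y
    unfolding D_def by (rule incidence_det_swap)
  have Un1: "D h (X \<union> X') Y = D h X Y + D h X' Y" if "X \<inter> X' = {}" for h X X' Y
    unfolding D_def by (rule incidence_det_Un[OF that])
  have Un2: "D h Y (X \<union> X') = D h Y X + D h Y X'" if "X \<inter> X' = {}" for h X X' Y
    using Un1[OF that] swap[of h Y] by simp
  have ins1: "D h (insert x X) Y = D h {x} Y + D h X Y" if "x \<notin> X" for h x X Y
    using Un1[of "{x}" X] that by simp
  have ins2: "D h Y (insert x X) = D h Y {x} + D h Y X" if "x \<notin> X" for h x X Y
    using Un2[of "{x}" X] that by simp
  have self: "D h X X = 0" for h X
    using swap[of h X X] by simp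
  have D_avoid: "D h X Y = 0" if "\<And>s. s < k \<Longrightarrow> h s \<notin> X" for h X Y
    unfolding D_def using that R(4) len by (intro incidence_det_avoid) simp
  \<comment> \<open>A point missed by \<open>h\<close> gives a zero row, and \<open>x\<close> is
    missed by \<open>f\<close> or by \<open>g\<close> on the indices below \<open>k\<close>.\<close>
  have avoid: "(\<forall>Y. D f {x} Y = 0) \<or> (\<forall>Y. D g {x} Y = 0)" for x
  proof (cases "\<exists>s<k. f s = x")
    case True
    hence "g t \<notin> {x}" if "t < k" for t using fg that by fastforce
    thus ?thesis using D_avoid by blast
  next
    case False
    hence "f s \<notin> {x}" if "s < k" for s using that by auto
    thus ?thesis using D_avoid by blast
  qed
  have expand:
    "D h (insert i A) (insert j B) = D h {i} {j} + D h {i} B - D h {j} A + D h A B"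
    "D h (insert j A) (insert i B) = - D h {i} {j} + D h {j} B - D h {i} A + D h A B"
    "D h {i, j} (A \<union> B) = D h {i} A + D h {i} B + D h {j} A + D h {j} B"
    "D h ({i, j} \<union> A) B = D h {i} B + D h {j} B + D h A B"
    "D h ({i, j} \<union> B) A = D h {i} A + D h {j} A - D h A B" for h
  proof -
    have pair: "D h {i, j} Y = D h {i} Y + D h {j} Y" for Y
      using ins1[of i "{j}"] AB(6) by simp
    have notin: "i \<notin> A" "i \<notin> B" "j \<notin> A" "j \<notin> B" "{i, j} \<inter> A = {}" "{i, j} \<inter> B = {}"
      using AB(4,5) by auto
    note sw = swap[of h "{i}" A] swap[of h "{j}" A] swap[of h "{i}" "{j}"] swap[of h A B]
    show "D h (insert i A) (insert j B) = D h {i} {j} + D h {i} B - D h {j} A + D h A B"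
      by (simp add: ins1[OF notin(1)] ins2[OF notin(4)] sw)
    show "D h (insert j A) (insert i B) = - D h {i} {j} + D h {j} B - D h {i} A + D h A B"
      by (simp add: ins1[OF notin(3)] ins2[OF notin(2)] sw)
    show "D h {i, j} (A \<union> B) = D h {i} A + D h {i} B + D h {j} A + D h {j} B"
      by (simp add: pair Un2[OF AB(3)])
    show "D h ({i, j} \<union> A) B = D h {i} B + D h {j} B + D h A B"
      unfolding Un1[OF notin(5)] pair by simp
    show "D h ({i, j} \<union> B) A = D h {i} A + D h {j} A - D h A B"
      unfolding Un1[OF notin(6)] pair by (simp add: sw)
  qed
  have F_expand:
    "F (insert i A) (insert j B) = D f (insert i A) (insert j B) * D g (insert i A) (insert j B)"
    "F (insert j A) (insert i B) = D f (insert j A) (insert i B) * D g (insert j A) (insert i B)"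
    "F {i, j} (A \<union> B) = D f {i, j} (A \<union> B) * D g {i, j} (A \<union> B)"
    "F ({i, j} \<union> A) B = D f ({i, j} \<union> A) B * D g ({i, j} \<union> A) B"
    "F ({i, j} \<union> B) A = D f ({i, j} \<union> B) A * D g ({i, j} \<union> B) A"
    by (rule F; use AB in blast)+
  show ?thesis
    unfolding F_expand expand
    \<comment> \<open>Four cases: which of the two determinants loses row \<open>i\<close>, and
      which loses row \<open>j\<close>.\<close>
    using avoid[of i] avoid[of j] swap[of f "{i}" "{j}"] swap[of g "{i}" "{j}"]
    by (elim disjE) (simp_all add: algebra_simps)
qed

text \<open>The row of \<open>{x}\<close> is zero in the incidence matrix of \<open>f\<close> or of
  \<open>g\<close>. Hence the terms deleted in \<open>skein\<close> can be restored without changing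
  the value of the functional.\<close>

lemma transversal_det_singleton:
  assumes fg: "\<And>s t. s < k \<Longrightarrow> t < k \<Longrightarrow> f s \<noteq> g t"
    and "finite \<pi>" "disjoint \<pi>" "card \<pi> = k" "{x} \<in> \<pi>"
  shows "transversal_det k f g \<pi> = 0"
proof -
  obtain Bs where Bs: "set Bs = \<pi> - {{x}}" "distinct Bs"
    using finite_distinct_list[of "\<pi> - {{x}}"] assms(2) by blast
  hence Bs': "set ({x} # Bs) = \<pi>" "distinct ({x} # Bs)" using assms(5) by auto
  hence len: "length ({x} # Bs) = k" using assms(4) distinct_card by metis
  have avoid: "incidence_det ({x} # Bs) h = 0" if "\<And>s. s < k \<Longrightarrow> h s \<notin> {x}" for h
    using that len by (intro incidence_det_avoid) simp
  have "incidence_det ({x} # Bs) f = 0 \<or> incidence_det ({x} # Bs) g = 0"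
  proof (cases "\<exists>s<k. f s = x")
    case True
    hence "g t \<notin> {x}" if "t < k" for t using fg that by fastforce
    thus ?thesis using avoid by blast
  next
    case False
    hence "f s \<notin> {x}" if "s < k" for s using that by auto
    thus ?thesis using avoid by blast
  qed
  thus ?thesis
    using transversal_det_eq[OF Bs'(2,1) assms(3), of f g] unfolding len by auto
qed

lemma transversal_det_perm_image:
  assumes "w permutes S"
  shows "transversal_det k (w \<circ> f) (w \<circ> g) (perm_image w \<pi>) = transversal_det k f g \<pi>"
proof -
  have "(\<exists>B\<in>perm_image w \<pi>. w x \<in> B \<and> w y \<in> B) \<longleftrightarrow> (\<exists>B\<in>\<pi>. x \<in> B \<and> y \<in> B)" for x y
    using perm_image_shares[OF assms, of \<pi> "{x, y}"] by simp
  thus ?thesis by (simp add: transversal_det_def)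
qed

subsection \<open>Minima and maxima of blocks\<close>

lemma partition_on_same_block:
  assumes "partition_on S \<pi>" "B \<in> \<pi>" "C \<in> \<pi>" "x \<in> B" "x \<in> C"
  shows "B = C"
  using assms by (meson disjointD disjoint_iff partition_onD2)

lemma block_eq:
  assumes "partition_on S \<pi>" "B \<in> \<pi>" "x \<in> B"
  shows "block x \<pi> = B"
  unfolding block_def using assms by (intro the_equality) (auto dest: partition_on_same_block)

lemma block_mem:
  assumes "partition_on S \<pi>" "x \<in> S"
  shows "block x \<pi> \<in> \<pi>" "x \<in> block x \<pi>"
proof -
  obtain B where "B \<in> \<pi>" "x \<in> B" using assms by (auto simp: partition_on_def)
  thus "block x \<pi> \<in> \<pi>" "x \<in> block x \<pi>" using block_eq[OF assms(1)] by auto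
qed

lemma partition_block_finite:
  assumes "partition_on S \<pi>" "finite S" "B \<in> \<pi>"
  shows "finite B" "B \<noteq> {}" "B \<subseteq> S"
  using assms by (auto simp: partition_on_def intro: finite_subset)

text \<open>One direction of the induction step for \<open>NC_eqI\<close>. Suppose the block
  \<open>B\<close> of \<open>x\<close> in \<open>\<pi>\<close> opens before the block
  \<open>B'\<close> of \<open>x\<close> in \<open>\<pi>'\<close>. The minimum of \<open>B'\<close>
  also opens a block \<open>C\<close> of \<open>\<pi>\<close>, strictly between \<open>Min B\<close>
  and \<open>x\<close>. If \<open>C\<close> ends after \<open>x\<close>, it crosses
  \<open>B\<close>. If \<open>C\<close> ends at some \<open>z < x\<close>, the induction hypothesis
  puts \<open>z\<close> into \<open>B'\<close>; as \<open>z\<close> is also the maximum of a block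
  of \<open>\<pi>'\<close>, the block \<open>B'\<close> ends before its element
  \<open>x\<close>.\<close>

lemma Min_block_not_less:
  assumes \<pi>: "\<pi> \<in> NC n" and \<pi>': "\<pi>' \<in> NC n"
    and mins: "Min ` \<pi> = Min ` \<pi>'" and maxs: "Max ` \<pi> = Max ` \<pi>'"
    and x: "x \<in> {1..n}"
    and IH: "\<And>z. z \<in> {1..n} \<Longrightarrow> z < x \<Longrightarrow> Min (block z \<pi>) = Min (block z \<pi>')"
  shows "\<not> Min (block x \<pi>) < Min (block x \<pi>')"
proof
  assume less: "Min (block x \<pi>) < Min (block x \<pi>')"
  have part: "partition_on {1..n} \<pi>" "partition_on {1..n} \<pi>'"
    using \<pi> \<pi>' by (auto simp: NC_def)
  define B where "B = block x \<pi>"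
  define B' where "B' = block x \<pi>'"
  have B: "B \<in> \<pi>" "x \<in> B" and B': "B' \<in> \<pi>'" "x \<in> B'"
    using block_mem part x by (auto simp: B_def B'_def)
  have fin: "finite C" "C \<noteq> {}" "C \<subseteq> {1..n}" if "C \<in> \<pi> \<or> C \<in> \<pi>'" for C
    using partition_block_finite part that by blast+
  have "Min B' \<in> Min ` \<pi>" using B' mins by blast
  then obtain C where C: "C \<in> \<pi>" "Min C = Min B'" by (metis imageE)
  have CB: "C \<noteq> B" using less C by (auto simp: B_def B'_def)
  hence xC: "x \<notin> C" using C(1) B partition_on_same_block[OF part(1)] by blast
  have MinC: "Min C \<in> C" and MaxC: "Max C \<in> C" and MinB: "Min B \<in> B"
    using fin C(1) B(1) by auto
  have "Min B' \<le> x" using fin B' by auto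
  hence lt: "Min C < x" using xC MinC C(2) by (metis le_neq_implies_less)
  have "Max C \<noteq> x" using xC MaxC by blast
  then consider "x < Max C" | "Max C < x" by linarith
  thus False
  proof cases
    case 1
    have "Min B < Min C" using less C(2) by (simp add: B_def B'_def)
    hence "\<exists>D\<in>\<pi>. Min B \<in> D \<and> Min C \<in> D \<and> x \<in> D \<and> Max C \<in> D"
      using lt 1 \<pi> MinB MinC MaxC B C(1) unfolding NC_def noncrossing_def by blast
    thus False using xC C(1) MinC partition_on_same_block[OF part(1)] by blast
  next
    case 2
    define z where "z = Max C"
    have z: "z \<in> {1..n}" "block z \<pi> = C"
      using block_eq[OF part(1) C(1) MaxC] fin(3)[of C] C(1) MaxC unfolding z_def by blast+
    define D where "D = block z \<pi>'"
    have D: "D \<in> \<pi>'" "z \<in> D" using block_mem[OF part(2) z(1)] by (auto simp: D_def)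
    have "Min D = Min B'" using IH[OF z(1)] 2 z(2) C(2) by (simp add: D_def z_def)
    moreover have "Min D \<in> D" "Min B' \<in> B'" using fin D(1) B'(1) by auto
    ultimately have DB: "D = B'" using D(1) B'(1) partition_on_same_block[OF part(2)] by metis
    have "z \<in> Max ` \<pi>'" using maxs C(1) by (auto simp: z_def)
    then obtain E where E: "E \<in> \<pi>'" "z = Max E" by blast
    hence "z \<in> E" using fin by auto
    hence "E = B'" using E(1) D DB partition_on_same_block[OF part(2)] by blast
    hence "x \<le> z" using E B'(2) fin by auto
    thus False using 2 by (simp add: z_def)
  qed
qed

text \<open>Read \<open>1, \<dots>, n\<close> from left to right: an element which is not the minimum of its block
  must belong to the most recently opened block that is not yet closed.\<close>

lemma NC_eqI:
  assumes \<pi>: "\<pi> \<in> NC n" and \<pi>': "\<pi>' \<in> NC n"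
    and mins: "Min ` \<pi> = Min ` \<pi>'" and maxs: "Max ` \<pi> = Max ` \<pi>'"
  shows "\<pi> = \<pi>'"
proof -
  have min_eq: "x \<in> {1..n} \<Longrightarrow> Min (block x \<pi>) = Min (block x \<pi>')" for x
  proof (induction x rule: less_induct)
    case (less x)
    have "\<not> Min (block x \<pi>) < Min (block x \<pi>')"
      using less by (intro Min_block_not_less[OF \<pi> \<pi>' mins maxs]) auto
    moreover have "\<not> Min (block x \<pi>') < Min (block x \<pi>)"
      using less by (intro Min_block_not_less[OF \<pi>' \<pi> mins[symmetric] maxs[symmetric]]) auto
    ultimately show ?case by simp
  qed
  \<comment> \<open>Distinct blocks have distinct minima, so the map from points to block minima
    recovers the partition.\<close>
  have determined: "\<rho> = (\<lambda>x. {y \<in> {1..n}. Min (block y \<rho>) = Min (block x \<rho>)}) ` {1..n}"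
    if "\<rho> \<in> NC n" for \<rho>
  proof -
    have part: "partition_on {1..n} \<rho>" using that by (simp add: NC_def)
    have block: "{y \<in> {1..n}. Min (block y \<rho>) = Min (block x \<rho>)} = block x \<rho>" (is "?L = _")
      if "x \<in> {1..n}" for x
    proof (intro equalityI subsetI)
      note x = block_mem[OF part that]
      show "y \<in> block x \<rho>" if "y \<in> ?L" for y
      proof -
        have y: "y \<in> {1..n}" "Min (block y \<rho>) = Min (block x \<rho>)" using that by auto
        note b = block_mem[OF part y(1)]
        have "Min (block y \<rho>) \<in> block y \<rho>" "Min (block x \<rho>) \<in> block x \<rho>"
          using b(1) x(1) partition_block_finite[OF part] by (auto intro!: Min_in)
        hence "block y \<rho> = block x \<rho>"
          using b(1) x(1) y(2) partition_on_same_block[OF part] by metis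
        thus ?thesis using b by simp
      qed
      show "y \<in> ?L" if "y \<in> block x \<rho>" for y
        using that block_eq[OF part x(1) that] partition_block_finite(3)[OF part _ x(1)] by auto
    qed
    have "\<rho> = (\<lambda>x. block x \<rho>) ` {1..n}"
    proof (intro equalityI subsetI)
      show "B \<in> (\<lambda>x. block x \<rho>) ` {1..n}" if "B \<in> \<rho>" for B
      proof -
        obtain x where "x \<in> B" "x \<in> {1..n}"
          using partition_block_finite[OF part finite_atLeastAtMost \<open>B \<in> \<rho>\<close>] by blast
        thus ?thesis using block_eq[OF part that] by blast
      qed
    qed (use block_mem[OF part] in auto)
    also have "\<dots> = (\<lambda>x. {y \<in> {1..n}. Min (block y \<rho>) = Min (block x \<rho>)}) ` {1..n}"
      using block by simp
    finally show ?thesis .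
  qed
  have "(\<lambda>x. {y \<in> {1..n}. Min (block y \<pi>) = Min (block x \<pi>)}) ` {1..n} =
      (\<lambda>x. {y \<in> {1..n}. Min (block y \<pi>') = Min (block x \<pi>')}) ` {1..n}"
    using min_eq by (intro image_cong refl) auto
  thus ?thesis using determined[OF \<pi>] determined[OF \<pi>'] by simp
qed

section \<open>Triangularity of the functionals given by minima and maxima\<close>

lemma transversal_det_commute: "transversal_det k g f \<pi> = transversal_det k f g \<pi>"
proof -
  let ?M = "\<lambda>f g. mat k k (\<lambda>(s, t). of_bool (\<exists>B\<in>\<pi>. f s \<in> B \<and> g t \<in> B)) :: rat mat"
  have "?M g f = transpose_mat (?M f g)"
    by (rule eq_matI) (auto simp: conj_commute)
  thus ?thesis
    unfolding transversal_det_def using det_transpose[of "?M f g" k] by simp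
qed

text \<open>A nonzero term of the Leibniz expansion puts every \<open>f s\<close> into some block.
  If two of them shared a block, the matrix would have two equal rows.\<close>

lemma transversal_det_nonzeroE:
  assumes nz: "transversal_det k f g \<pi> \<noteq> 0"
    and \<pi>: "finite \<pi>" "disjoint \<pi>" "card \<pi> = k"
  obtains b where "bij_betw b {..<k} \<pi>" "\<And>s. s < k \<Longrightarrow> f s \<in> b s"
proof -
  let ?M = "mat k k (\<lambda>(s, t). of_bool (\<exists>B\<in>\<pi>. f s \<in> B \<and> g t \<in> B)) :: rat mat"
  have M: "?M \<in> carrier_mat k k" by simp
  have det: "det ?M \<noteq> 0" using nz by (simp add: transversal_det_def)
  hence "(\<Sum>p | p permutes {0..<k}. signof p * (\<Prod>s = 0..<k. ?M $$ (s, p s))) \<noteq> 0"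
    using det_def'[OF M] by simp
  then obtain p where p: "p permutes {0..<k}" "(\<Prod>s = 0..<k. ?M $$ (s, p s)) \<noteq> 0"
    by (metis (mono_tags, lifting) mem_Collect_eq mult_zero_right sum.neutral)
  have "\<exists>B\<in>\<pi>. f s \<in> B" if "s < k" for s
  proof -
    have "?M $$ (s, p s) \<noteq> 0" "p s < k"
      using p that permutes_in_image[OF p(1)] by (auto simp: prod_zero_iff)
    thus ?thesis using that by (auto split: if_splits)
  qed
  then obtain b where b: "\<And>s. s < k \<Longrightarrow> b s \<in> \<pi> \<and> f s \<in> b s" by metis
  have "inj_on b {..<k}"
  proof (rule inj_onI, rule ccontr)
    fix s t assume st: "s \<in> {..<k}" "t \<in> {..<k}" "b s = b t" "s \<noteq> t"
    have uniq: "B = b s" if "B \<in> \<pi>" "f s \<in> B \<or> f t \<in> B" for B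
      using that b[of s] b[of t] st \<pi>(2) by (metis disjointD disjoint_iff lessThan_iff)
    have "(\<exists>B\<in>\<pi>. f s \<in> B \<and> y \<in> B) \<longleftrightarrow> (\<exists>B\<in>\<pi>. f t \<in> B \<and> y \<in> B)" for y
      using uniq b[of s] b[of t] st by auto
    hence "row ?M s = row ?M t" using st by (intro eq_vecI) auto
    thus False using det_identical_rows[OF M st(4)] st det by auto
  qed
  moreover have "b ` {..<k} \<subseteq> \<pi>" using b by auto
  ultimately have "bij_betw b {..<k} \<pi>"
    using \<pi> by (metis bij_betw_def card_image card_lessThan card_subset_eq)
  thus ?thesis using that b by blast
qed

lemma sum_less_eq_imp_eq:
  fixes a b :: "'a \<Rightarrow> nat"
  assumes "finite S" "\<And>s. s \<in> S \<Longrightarrow> a s \<le> b s" "sum b S \<le> sum a S" "s \<in> S"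
  shows "a s = b s"
  using assms sum_strict_mono_ex1[of S a b] by (metis le_neq_implies_less not_le)

text \<open>Both the minima and the maxima of \<open>\<pi>\<close> are transversals of
  \<open>\<pi>'\<close>. So the minima of \<open>\<pi>'\<close> have at most the sum of those of
  \<open>\<pi>\<close>, and its maxima at least the corresponding sum. The bound \<open>le\<close>
  forces equality in both, hence termwise, and \<open>NC_eqI\<close> applies.\<close>

lemma transversal_det_Min_Max:
  assumes \<pi>: "\<pi> \<in> NC n" "card \<pi> = k" and \<pi>': "\<pi>' \<in> NC n" "card \<pi>' = k"
    and Bs: "set Bs = \<pi>" "distinct Bs"
    and nz: "transversal_det k (\<lambda>s. Min (Bs ! s)) (\<lambda>s. Max (Bs ! s)) \<pi>' \<noteq> 0"
    and le: "(\<Sum>B\<in>\<pi>'. int (Max B) - int (Min B)) \<le> (\<Sum>B\<in>\<pi>. int (Max B) - int (Min B))"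
  shows "\<pi>' = \<pi>"
proof -
  have part: "partition_on {1..n} \<pi>" "partition_on {1..n} \<pi>'"
    using \<pi> \<pi>' by (auto simp: NC_def)
  have fin: "finite \<pi>" "finite \<pi>'" using part finite_elements by blast+
  have disj: "disjoint \<pi>'" using part by (simp add: partition_on_def)
  have bl: "finite B" "B \<noteq> {}" if "B \<in> \<pi>'" for B
    using partition_block_finite part that by blast+
  have len: "length Bs = k" using Bs \<pi> distinct_card by fastforce
  have e: "bij_betw ((!) Bs) {..<k} \<pi>" using bij_betw_nth[OF Bs(2)] Bs(1) len by simp
  \<comment> \<open>The block of \<open>\<pi>'\<close> containing the minimum of
    \<open>Bs ! s\<close> is \<open>a s\<close>; the one containing its maximum will be
    \<open>b s\<close>. The two may differ, so only the separate sums of minima and of maxima are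
    compared.\<close>
  obtain a where a: "bij_betw a {..<k} \<pi>'" "\<And>s. s < k \<Longrightarrow> Min (Bs ! s) \<in> a s"
    using transversal_det_nonzeroE[OF nz fin(2) disj \<pi>'(2)] by blast
  obtain b where b: "bij_betw b {..<k} \<pi>'" "\<And>s. s < k \<Longrightarrow> Max (Bs ! s) \<in> b s"
    using transversal_det_nonzeroE[OF _ fin(2) disj \<pi>'(2)] nz transversal_det_commute by metis
  have a_le: "Min (a s) \<le> Min (Bs ! s)" if "s < k" for s
    using a that bl bij_betwE[OF a(1)] by (intro Min_le) auto
  have b_le: "Max (Bs ! s) \<le> Max (b s)" if "s < k" for s
    using b that bl bij_betwE[OF b(1)] by (intro Max_ge) auto
  have sums: "(\<Sum>s<k. Min (a s)) = sum Min \<pi>'" "(\<Sum>s<k. Max (b s)) = sum Max \<pi>'"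
    "(\<Sum>s<k. Min (Bs ! s)) = sum Min \<pi>" "(\<Sum>s<k. Max (Bs ! s)) = sum Max \<pi>"
    using sum.reindex_bij_betw a(1) b(1) e by metis+
  have "sum Min \<pi>' \<le> sum Min \<pi>" "sum Max \<pi> \<le> sum Max \<pi>'"
    unfolding sums[symmetric] by (intro sum_mono; use a_le b_le in simp)+
  moreover have "int (sum Max \<pi>') - int (sum Min \<pi>') \<le> int (sum Max \<pi>) - int (sum Min \<pi>)"
    using le by (simp add: sum_subtractf)
  ultimately have "sum Min \<pi> \<le> sum Min \<pi>'" "sum Max \<pi>' \<le> sum Max \<pi>" by linarith+
  hence "Min (a s) = Min (Bs ! s)" "Max (Bs ! s) = Max (b s)" if "s < k" for s
    using sum_less_eq_imp_eq[of "{..<k}" "\<lambda>s. Min (a s)" "\<lambda>s. Min (Bs ! s)" s]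
      sum_less_eq_imp_eq[of "{..<k}" "\<lambda>s. Max (Bs ! s)" "\<lambda>s. Max (b s)" s]
      a_le b_le that unfolding sums by auto
  hence "Min ` a ` {..<k} = Min ` (!) Bs ` {..<k}" "Max ` b ` {..<k} = Max ` (!) Bs ` {..<k}"
    unfolding image_image by (intro image_cong; simp)+
  hence "Min ` \<pi>' = Min ` \<pi>" "Max ` \<pi>' = Max ` \<pi>"
    using a(1) b(1) e by (simp_all only: bij_betw_def)
  thus ?thesis using NC_eqI[OF \<pi>'(1) \<pi>(1)] by simp
qed

subsection \<open>Functionals on the span of set partitions\<close>

text \<open>The linear extension of \<open>transversal_det\<close>. It lives on the whole free
  space, so it can be evaluated on skein terms before they are known to be noncrossing.\<close>

definition pairing :: "nat \<Rightarrow> (nat \<Rightarrow> nat) \<Rightarrow> (nat \<Rightarrow> nat) \<Rightarrow> partition_vec \<Rightarrow> rat" where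
  "pairing k f g v =
     (\<Sum>\<pi>\<in>Poly_Mapping.keys v. Poly_Mapping.lookup v \<pi> * transversal_det k f g \<pi>)"

lemma pairing_eq_sum:
  assumes "finite S" "Poly_Mapping.keys v \<subseteq> S"
  shows "pairing k f g v = (\<Sum>\<pi>\<in>S. Poly_Mapping.lookup v \<pi> * transversal_det k f g \<pi>)"
  unfolding pairing_def using assms
  by (intro sum.mono_neutral_left) (auto simp: in_keys_iff)

lemma pairing_add: "pairing k f g (u + v) = pairing k f g u + pairing k f g v"
proof -
  let ?S = "Poly_Mapping.keys u \<union> Poly_Mapping.keys v"
  show ?thesis
    using Poly_Mapping.keys_add[of u v]
    by (simp add: pairing_eq_sum[of ?S] lookup_add sum.distrib algebra_simps)
qed

lemma keys_scale: "Poly_Mapping.keys (scale q v) \<subseteq> Poly_Mapping.keys v"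
  by (auto simp: in_keys_iff)

lemma pairing_scale: "pairing k f g (scale q v) = q * pairing k f g v"
  using keys_scale[of q v]
  by (simp add: pairing_eq_sum[of "Poly_Mapping.keys v"] sum_distrib_left mult.assoc)

lemma pairing_uminus: "pairing k f g (- v) = - pairing k f g v"
  by (simp add: pairing_def sum_negf)

lemma pairing_diff: "pairing k f g (u - v) = pairing k f g u - pairing k f g v"
  using pairing_add[of k f g u "- v"] by (simp add: pairing_uminus)

lemma pairing_zero: "pairing k f g 0 = 0"
  by (simp add: pairing_def)

lemma pairing_sum: "pairing k f g (sum h S) = (\<Sum>x\<in>S. pairing k f g (h x))"
  by (induction S rule: infinite_finite_induct) (auto simp: pairing_zero pairing_add)

lemma pairing_basis_vec: "pairing k f g (basis_vec \<pi>) = transversal_det k f g \<pi>"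
  by (simp add: pairing_def basis_vec_def)

lemma keys_basis_vec: "Poly_Mapping.keys (basis_vec \<pi>) = {\<pi>}"
  by (simp add: basis_vec_def)

section \<open>Singleton-free partitions and the skein map\<close>

definition singleton_free :: "nat \<Rightarrow> nat \<Rightarrow> set_partition set" where
  "singleton_free n k = {\<pi>. partition_on {1..n} \<pi> \<and> card \<pi> = k \<and> (\<forall>x. {x} \<notin> \<pi>)}"

lemma NCks_0: "NCks n k 0 = NC n \<inter> singleton_free n k"
proof -
  have "card {B \<in> \<pi>. card B = 1} = 0 \<longleftrightarrow> (\<forall>x. {x} \<notin> \<pi>)" if "\<pi> \<in> NC n" for \<pi>
  proof -
    have "finite \<pi>" using that finite_elements[of "{1..n}" \<pi>] by (simp add: NC_def)
    thus ?thesis by (auto simp: card_1_singleton_iff)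
  qed
  thus ?thesis by (auto simp: NCks_def singleton_free_def NC_def)
qed

lemma adj_permutes: "i \<in> {1..<n} \<Longrightarrow> adj i permutes {1..n}"
  unfolding adj_def by (intro permutes_swap_id) auto

lemma card_perm_image:
  assumes "w permutes S"
  shows "card (perm_image w \<pi>) = card \<pi>"
  using permutes_inj[OF assms] unfolding perm_image_def
  by (intro card_image) (auto simp: inj_on_def inj_image_eq_iff)

lemma singleton_free_perm_image:
  assumes "w permutes {1..n}" "\<pi> \<in> singleton_free n k"
  shows "perm_image w \<pi> \<in> singleton_free n k"
proof -
  have "{x} \<notin> perm_image w \<pi>" for x
  proof
    assume "{x} \<in> perm_image w \<pi>"
    then obtain B where B: "B \<in> \<pi>" "w ` B = {x}" by (auto simp: perm_image_def)
    hence "card B = 1" 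
      using card_image[of w B] permutes_inj_on[OF assms(1)] by (metis is_singletonI is_singleton_altdef)
    thus False using B(1) assms(2) by (auto simp: card_1_singleton_iff singleton_free_def)
  qed
  thus ?thesis
    using assms partition_on_perm_image[OF assms(1)] card_perm_image[OF assms(1)]
    by (simp add: singleton_free_def)
qed

lemma block_perm_image:
  assumes "w permutes S" "partition_on S \<pi>" "x \<in> S"
  shows "block (w x) (perm_image w \<pi>) = w ` block x \<pi>"
  using block_mem[OF assms(2,3)]
  by (intro block_eq[OF partition_on_perm_image[OF assms(1,2)]]) (auto simp: perm_image_def)

lemma card_Diff_two:
  assumes "finite S" "x \<in> S" "y \<in> S" "x \<noteq> y"
  shows "card S = card (S - {x, y}) + 2"
proof -
  have "card {x, y} \<le> card S" by (rule card_mono) (use assms in auto)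
  thus ?thesis using assms card_Diff_subset[of "{x, y}" S] by simp
qed

lemma partition_on_replace_two:
  assumes \<sigma>: "partition_on S \<sigma>" "finite S" "P \<in> \<sigma>" "Q \<in> \<sigma>" "P \<noteq> Q"
    and XY: "X \<union> Y = P \<union> Q" "X \<inter> Y = {}" "X \<noteq> {}" "Y \<noteq> {}"
  shows "partition_on S (\<sigma> - {P, Q} \<union> {X, Y})" "card (\<sigma> - {P, Q} \<union> {X, Y}) = card \<sigma>"
proof -
  let ?R = "\<sigma> - {P, Q}"
  have avoid: "C \<inter> (X \<union> Y) = {}" if "C \<in> ?R" for C
    unfolding XY(1) using that \<sigma> partition_on_same_block[OF \<sigma>(1)] by blast
  have "\<Union> (?R \<union> {X, Y}) = \<Union> ?R \<union> (P \<union> Q)" using XY(1) by auto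
  also have "\<dots> = S" using partition_onD1[OF \<sigma>(1)] \<sigma>(3,4) by blast
  finally have union: "\<Union> (?R \<union> {X, Y}) = S" .
  have "disjoint ?R" using partition_onD2[OF \<sigma>(1)] by (rule pairwise_subset) blast
  moreover have "disjoint {X, Y}" using XY(2) by (simp add: pairwise_insert disjnt_def Int_commute)
  moreover have "\<Union>?R \<inter> \<Union>{X, Y} = {}" using avoid by fastforce
  ultimately have "disjoint (?R \<union> {X, Y})" by (rule disjoint_union)
  thus "partition_on S (?R \<union> {X, Y})"
    using union partition_onD3[OF \<sigma>(1)] XY by (simp add: partition_on_def)
  have fin: "finite \<sigma>" using finite_elements[OF \<sigma>(2,1)] .
  have "X \<notin> ?R" "Y \<notin> ?R" "X \<noteq> Y"
    using avoid[of X] avoid[of Y] XY(2-4) by blast+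
  hence "card (?R \<union> {X, Y}) = card ?R + 2" using fin by simp
  also have "\<dots> = card \<sigma>" using card_Diff_two[OF fin \<sigma>(3-5)] by simp
  finally show "card (?R \<union> {X, Y}) = card \<sigma>" .
qed

text \<open>The five-term relation for the blocks of \<open>i\<close> and \<open>Suc i\<close>,
  solved for the terms of \<open>skein\<close>. A term is deleted exactly when \<open>A\<close> or
  \<open>B\<close> would become a singleton block in it, and there the functional is zero.\<close>

lemma skein_singleton_free:
  assumes \<sigma>: "\<sigma> \<in> singleton_free n k" and i: "i \<in> {1..<n}"
    and ne: "block i \<sigma> \<noteq> block (Suc i) \<sigma>"
  shows "Poly_Mapping.keys (skein i \<sigma>) \<subseteq> singleton_free n k"
    and "(\<And>s t. s < k \<Longrightarrow> t < k \<Longrightarrow> f s \<noteq> g t) \<Longrightarrow>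
      pairing k f g (skein i \<sigma>) = - transversal_det k f g \<sigma>"
proof -
  define P where "P = block i \<sigma>"
  define Q where "Q = block (Suc i) \<sigma>"
  define A where "A = P - {i}"
  define B where "B = Q - {Suc i}"
  define R where "R = \<sigma> - {P, Q}"
  have part: "partition_on {1..n} \<sigma>" and card: "card \<sigma> = k" and nosing: "{x} \<notin> \<sigma>" for x
    using \<sigma> by (auto simp: singleton_free_def)
  have fin: "finite \<sigma>" using finite_elements[OF _ part] by simp
  have P: "P \<in> \<sigma>" "i \<in> P" and Q: "Q \<in> \<sigma>" "Suc i \<in> Q"
    unfolding P_def Q_def using i by (intro block_mem[OF part]; simp)+
  have PQ: "P \<inter> Q = {}" using ne P Q partition_on_same_block[OF part] P_def Q_def by blast
  have PA: "P = insert i A" and QB: "Q = insert (Suc i) B"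
    using P Q by (auto simp: A_def B_def)
  have AB: "A \<noteq> {}" "B \<noteq> {}" "A \<inter> B = {}" "i \<notin> A \<union> B" "Suc i \<notin> A \<union> B"
  proof -
    show "A \<noteq> {}" using PA P(1) nosing[of i] by metis
    show "B \<noteq> {}" using QB Q(1) nosing[of "Suc i"] by metis
    show "A \<inter> B = {}" "i \<notin> A \<union> B" "Suc i \<notin> A \<union> B"
      using PQ P(2) Q(2) unfolding A_def B_def by blast+
  qed
  have finAB: "finite A" "finite B"
    using partition_block_finite(1)[OF part _ P(1)] partition_block_finite(1)[OF part _ Q(1)]
    by (auto simp: A_def B_def)
  have \<sigma>_eq: "\<sigma> = R \<union> {insert i A, insert (Suc i) B}"
    using P(1) Q(1) unfolding R_def PA[symmetric] QB[symmetric] by blast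
  have disj: "(A \<union> B \<union> {i, Suc i}) \<inter> \<Union>R = {}"
    using partition_on_same_block[OF part] P Q unfolding R_def A_def B_def by blast
  have adj_R: "adj i ` C = C" if "C \<in> R" for C
    using disj that by (auto simp: adj_def Transposition.transpose_def)
  have adj_A: "adj i ` insert i A = insert (Suc i) A" and adj_B: "adj i ` insert (Suc i) B = insert i B"
    using AB by (auto simp: adj_def Transposition.transpose_def image_iff)
  have \<sigma>1: "perm_image (adj i) \<sigma> = R \<union> {insert (Suc i) A, insert i B}"
  proof -
    have "(`) (adj i) ` R = R" using adj_R by simp
    thus ?thesis
      unfolding perm_image_def
      by (subst \<sigma>_eq) (simp only: image_Un image_insert[of "(`) (adj i)"] image_empty adj_A adj_B)
  qed
  let ?\<sigma>2 = "R \<union> {{i, Suc i}, A \<union> B}"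
  let ?\<sigma>3 = "R \<union> {{i, Suc i} \<union> A, B}"
  let ?\<sigma>4 = "R \<union> {{i, Suc i} \<union> B, A}"
  have skein: "skein i \<sigma> = basis_vec (perm_image (adj i) \<sigma>) + basis_vec ?\<sigma>2
      - (if card B = 1 then 0 else basis_vec ?\<sigma>3) - (if card A = 1 then 0 else basis_vec ?\<sigma>4)"
    unfolding skein_def Let_def by (simp add: P_def Q_def A_def B_def R_def)
  have replace: "partition_on {1..n} (R \<union> {X, Y}) \<and> card (R \<union> {X, Y}) = k"
    if "X \<union> Y = P \<union> Q" "X \<inter> Y = {}" "X \<noteq> {}" "Y \<noteq> {}" for X Y
    using partition_on_replace_two[OF part _ P(1) Q(1) _ that] PQ P card unfolding R_def by auto
  have "P \<union> Q = A \<union> B \<union> {i, Suc i}" using PA QB by auto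
  hence r2: "partition_on {1..n} ?\<sigma>2 \<and> card ?\<sigma>2 = k"
    and r3: "partition_on {1..n} ?\<sigma>3 \<and> card ?\<sigma>3 = k"
    and r4: "partition_on {1..n} ?\<sigma>4 \<and> card ?\<sigma>4 = k"
    by (intro replace; use AB in auto)+
  have nosing': "R \<union> {X, Y} \<in> singleton_free n k"
    if "partition_on {1..n} (R \<union> {X, Y}) \<and> card (R \<union> {X, Y}) = k" "card X \<noteq> 1" "card Y \<noteq> 1" for X Y
    using that nosing by (auto simp: singleton_free_def R_def)
  \<comment> \<open>Among the blocks of the new partitions only \<open>A\<close> and
    \<open>B\<close> standing alone can be singletons.\<close>
  have cards: "card {i, Suc i} \<noteq> 1" "card ({i, Suc i} \<union> A) \<noteq> 1" "card ({i, Suc i} \<union> B) \<noteq> 1"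
    "card (A \<union> B) \<noteq> 1"
  proof -
    have "card A \<ge> 1" "card B \<ge> 1" using AB finAB by (simp_all add: Suc_le_eq card_gt_0_iff)
    thus "card {i, Suc i} \<noteq> 1" "card ({i, Suc i} \<union> A) \<noteq> 1" "card ({i, Suc i} \<union> B) \<noteq> 1"
      "card (A \<union> B) \<noteq> 1"
      using AB finAB by (simp_all add: card_Un_disjoint)
  qed
  have mem: "perm_image (adj i) \<sigma> \<in> singleton_free n k" "?\<sigma>2 \<in> singleton_free n k"
    "card B \<noteq> 1 \<Longrightarrow> ?\<sigma>3 \<in> singleton_free n k" "card A \<noteq> 1 \<Longrightarrow> ?\<sigma>4 \<in> singleton_free n k"
    using singleton_free_perm_image[OF adj_permutes[OF i] \<sigma>] nosing' r2 r3 r4 cards by blast+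
  show "Poly_Mapping.keys (skein i \<sigma>) \<subseteq> singleton_free n k"
    unfolding skein
    using mem by (intro order_trans[OF keys_diff] order_trans[OF Poly_Mapping.keys_add] Un_least)
      (auto simp: keys_basis_vec)
  assume fg: "\<And>s t. s < k \<Longrightarrow> t < k \<Longrightarrow> f s \<noteq> g t"
  have zero: "transversal_det k f g (R \<union> {X, Y}) = 0"
    if "partition_on {1..n} (R \<union> {X, Y}) \<and> card (R \<union> {X, Y}) = k" "card Y = 1" for X Y
  proof -
    obtain x where "Y = {x}" using \<open>card Y = 1\<close> by (auto simp: card_1_singleton_iff)
    thus ?thesis
      using that(1) finite_elements[of "{1..n}" "R \<union> {X, Y}"]
      by (intro transversal_det_singleton[where x = x] fg) (auto simp: partition_on_def)
  qed
  have "finite R" "disjoint R" "{} \<notin> R" "k = card R + 2"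
    using fin partition_onD2[OF part] partition_onD3[OF part] card
      card_Diff_two[OF fin P(1) Q(1)] ne
    unfolding R_def P_def Q_def by (auto intro: pairwise_subset)
  hence "transversal_det k f g \<sigma> + transversal_det k f g (perm_image (adj i) \<sigma>)
      + transversal_det k f g ?\<sigma>2 - transversal_det k f g ?\<sigma>3 - transversal_det k f g ?\<sigma>4 = 0"
    using five_term_relation[of k f g R A B i "Suc i", OF fg _ _ _ _ AB _ disj]
    by (simp only: \<sigma>1 \<sigma>_eq[symmetric] n_not_Suc_n not_False_eq_True)
  thus "pairing k f g (skein i \<sigma>) = - transversal_det k f g \<sigma>"
    unfolding skein using zero[OF r3] zero[OF r4]
    by (cases "card A = 1"; cases "card B = 1")
      (simp_all add: pairing_add pairing_diff pairing_basis_vec pairing_zero)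
qed

subsection \<open>The operators \<open>\<tau>\<^sub>i\<close>\<close>

lemma noncrossingD:
  assumes "noncrossing \<pi>" "partition_on S \<pi>" "P \<in> \<pi>" "Q \<in> \<pi>"
    and "a < b" "b < c" "c < d" "a \<in> P" "c \<in> P" "b \<in> Q" "d \<in> Q"
  shows "P = Q"
proof -
  obtain B where "B \<in> \<pi>" "a \<in> B" "b \<in> B"
    using assms unfolding noncrossing_def by blast
  thus ?thesis using assms partition_on_same_block by metis
qed

text \<open>Choose a further point \<open>a\<close> in the block of \<open>i\<close> and
  \<open>b\<close> in the block of \<open>Suc i\<close>. Exchanging \<open>i\<close> and
  \<open>Suc i\<close> toggles whether the chords from these two points to \<open>a\<close> and
  \<open>b\<close> cross, so one of \<open>\<pi>\<close> and \<open>s_i(\<pi>)\<close> is crossing.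
  Thus the first branch of \<open>tau_basis\<close> never occurs here.\<close>

lemma not_noncrossing_adj:
  assumes \<pi>: "\<pi> \<in> NC n \<inter> singleton_free n k" and i: "i \<in> {1..<n}"
    and ne: "block i \<pi> \<noteq> block (Suc i) \<pi>"
  shows "\<not> noncrossing (perm_image (adj i) \<pi>)"
proof
  assume nc': "noncrossing (perm_image (adj i) \<pi>)"
  have part: "partition_on {1..n} \<pi>" and nc: "noncrossing \<pi>" and nosing: "{x} \<notin> \<pi>" for x
    using \<pi> by (auto simp: singleton_free_def NC_def)
  note part' = partition_on_perm_image[OF adj_permutes[OF i] part]
  define P where "P = block i \<pi>"
  define Q where "Q = block (Suc i) \<pi>"
  have P: "P \<in> \<pi>" "i \<in> P" and Q: "Q \<in> \<pi>" "Suc i \<in> Q"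
    unfolding P_def Q_def using i by (intro block_mem[OF part]; simp)+
  have PQ: "P \<inter> Q = {}" "P \<noteq> Q" using ne P Q partition_on_same_block[OF part] P_def Q_def by blast+
  have "P \<noteq> {i}" "Q \<noteq> {Suc i}" using P(1) Q(1) nosing by metis+
  then obtain a b where a: "a \<in> P" "a \<noteq> i" and b: "b \<in> Q" "b \<noteq> Suc i"
    using P(2) Q(2) by blast
  have neq: "a \<noteq> Suc i" "b \<noteq> i" "a \<noteq> b" using a(1) b(1) P(2) Q(2) PQ(1) by blast+
  define P' where "P' = adj i ` P"
  define Q' where "Q' = adj i ` Q"
  have adj: "adj i i = Suc i" "adj i (Suc i) = i" "adj i a = a" "adj i b = b"
    using a(2) b(2) neq by (simp_all add: adj_def Transposition.transpose_def)
  have P': "P' \<in> perm_image (adj i) \<pi>" "Suc i \<in> P'" "a \<in> P'"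
    and Q': "Q' \<in> perm_image (adj i) \<pi>" "i \<in> Q'" "b \<in> Q'"
    unfolding P'_def Q'_def perm_image_def
    using P Q imageI[OF P(2), of "adj i"] imageI[OF Q(2), of "adj i"]
      imageI[OF a(1), of "adj i"] imageI[OF b(1), of "adj i"]
    unfolding adj by (simp_all only: imageI)
  have ne': "P' \<noteq> Q'"
    using PQ(2) permutes_inj[OF adj_permutes[OF i]] by (simp add: P'_def Q'_def inj_image_eq_iff)
  \<comment> \<open>Cases 1, 4 and 5 are the arrangements that cross in \<open>\<pi>\<close>, the
    others those that cross in \<open>s_i(\<pi>)\<close>.\<close>
  consider "a < b" "b < i" | "b < a" "a < i" | "a < i" "Suc i < b" | "b < i" "Suc i < a"
    | "Suc i < a" "a < b" | "Suc i < b" "b < a"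
    using a b neq by linarith
  thus False
  proof cases
    case 1
    thus ?thesis using noncrossingD[OF nc part P(1) Q(1), of a b i "Suc i"] a(1) b(1) P(2) Q(2) PQ(2) by simp
  next
    case 2
    thus ?thesis using noncrossingD[OF nc' part' Q'(1) P'(1), of b a i "Suc i"] P'(2,3) Q'(2,3) ne' by simp
  next
    case 3
    thus ?thesis using noncrossingD[OF nc' part' P'(1) Q'(1), of a i "Suc i" b] P'(2,3) Q'(2,3) ne' by simp
  next
    case 4
    thus ?thesis using noncrossingD[OF nc part Q(1) P(1), of b i "Suc i" a] a(1) b(1) P(2) Q(2) PQ(2) by simp
  next
    case 5
    thus ?thesis using noncrossingD[OF nc part P(1) Q(1), of i "Suc i" a b] a(1) b(1) P(2) Q(2) PQ(2) by simp
  next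
    case 6
    thus ?thesis using noncrossingD[OF nc' part' Q'(1) P'(1), of i "Suc i" b a] P'(2,3) Q'(2,3) ne' by simp
  qed
qed

text \<open>If \<open>i\<close> and \<open>Suc i\<close> share a block, \<open>s_i\<close> fixes the
  partition and \<open>tau_basis\<close> negates it. Otherwise the skein branch applies, to
  \<open>s_i(\<pi>)\<close>.\<close>

lemma tau_basis_singleton_free:
  assumes \<pi>: "\<pi> \<in> NC n \<inter> singleton_free n k" and i: "i \<in> {1..<n}"
  shows "Poly_Mapping.keys (tau_basis i \<pi>) \<subseteq> singleton_free n k"
    and "(\<And>s t. s < k \<Longrightarrow> t < k \<Longrightarrow> f s \<noteq> g t) \<Longrightarrow>
      pairing k f g (tau_basis i \<pi>) = - transversal_det k f g (perm_image (adj i) \<pi>)"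
proof -
  let ?\<sigma> = "perm_image (adj i) \<pi>"
  have part: "partition_on {1..n} \<pi>" using \<pi> by (simp add: NC_def)
  have dom: "i \<in> {1..n}" "Suc i \<in> {1..n}" using i by auto
  have adj: "adj i i = Suc i" "adj i (Suc i) = i" by (auto simp: adj_def)
  have "Poly_Mapping.keys (tau_basis i \<pi>) \<subseteq> singleton_free n k \<and>
    ((\<forall>s<k. \<forall>t<k. f s \<noteq> g t) \<longrightarrow>
      pairing k f g (tau_basis i \<pi>) = - transversal_det k f g ?\<sigma>)"
  proof (cases "block i \<pi> = block (Suc i) \<pi>")
    case True
    have "adj i ` B = B" if "B \<in> \<pi>" for B
    proof -
      have "i \<in> B \<longleftrightarrow> Suc i \<in> B"
        using True block_mem[OF part dom(1)] block_mem[OF part dom(2)] that block_eq[OF part that]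
        by metis
      thus ?thesis unfolding adj_def by (cases "i \<in> B") (simp_all add: transpose_image_eq)
    qed
    hence "?\<sigma> = \<pi>" by (simp add: perm_image_def)
    thus ?thesis using True \<pi>
      by (simp add: tau_basis_def keys_basis_vec pairing_uminus pairing_basis_vec)
  next
    case False
    have "block i ?\<sigma> \<noteq> block (Suc i) ?\<sigma>"
      using block_perm_image[OF adj_permutes[OF i] part dom(1)]
        block_perm_image[OF adj_permutes[OF i] part dom(2)] False
        permutes_inj[OF adj_permutes[OF i]]
      by (simp add: adj inj_image_eq_iff)
    moreover have "?\<sigma> \<in> singleton_free n k"
      using singleton_free_perm_image[OF adj_permutes[OF i]] \<pi> by blast
    moreover have "tau_basis i \<pi> = skein i ?\<sigma>"
      using False not_noncrossing_adj[OF \<pi> i False] by (simp add: tau_basis_def)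
    ultimately show ?thesis
      using skein_singleton_free[OF _ i, of ?\<sigma>] by simp
  qed
  thus "Poly_Mapping.keys (tau_basis i \<pi>) \<subseteq> singleton_free n k"
    and "(\<And>s t. s < k \<Longrightarrow> t < k \<Longrightarrow> f s \<noteq> g t) \<Longrightarrow>
      pairing k f g (tau_basis i \<pi>) = - transversal_det k f g ?\<sigma>"
    by blast+
qed

lemma tau_singleton_free:
  assumes v: "Poly_Mapping.keys v \<subseteq> NC n \<inter> singleton_free n k" and i: "i \<in> {1..<n}"
  shows "Poly_Mapping.keys (tau i v) \<subseteq> singleton_free n k"
    and "(\<And>s t. s < k \<Longrightarrow> t < k \<Longrightarrow> f s \<noteq> g t) \<Longrightarrow>
      pairing k (adj i \<circ> f) (adj i \<circ> g) (tau i v) = - pairing k f g v"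
proof -
  have "Poly_Mapping.keys (\<Sum>\<pi>\<in>S. scale (q \<pi>) (tau_basis i \<pi>)) \<subseteq> singleton_free n k"
    if "S \<subseteq> NC n \<inter> singleton_free n k" for S q
    using that
  proof (induction S rule: infinite_finite_induct)
    case (insert \<pi> S)
    show ?case
      unfolding sum.insert[OF insert.hyps]
      by (intro order_trans[OF Poly_Mapping.keys_add] Un_least order_trans[OF keys_scale]
          tau_basis_singleton_free(1) i insert.IH) (use insert.prems in auto)
  qed simp_all
  thus "Poly_Mapping.keys (tau i v) \<subseteq> singleton_free n k"
    unfolding tau_def using v by blast
  assume fg: "\<And>s t. s < k \<Longrightarrow> t < k \<Longrightarrow> f s \<noteq> g t"
  have "inj (adj i)" by (rule permutes_inj[OF adj_permutes[OF i]])
  hence fg': "(adj i \<circ> f) s \<noteq> (adj i \<circ> g) t" if "s < k" "t < k" for s t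
    using fg[OF that] by (simp add: inj_eq)
  have "pairing k (adj i \<circ> f) (adj i \<circ> g) (tau_basis i \<pi>) = - transversal_det k f g \<pi>"
    if "\<pi> \<in> Poly_Mapping.keys v" for \<pi>
  proof -
    have "\<pi> \<in> NC n \<inter> singleton_free n k" using v that by auto
    \<comment> \<open>The functional of the moved pair takes at \<open>s_i(\<pi>)\<close> the value
      that the original one takes at \<open>\<pi>\<close>.\<close>
    from tau_basis_singleton_free(2)[OF this i, where f = "adj i \<circ> f" and g = "adj i \<circ> g", OF fg']
    show ?thesis using transversal_det_perm_image[OF adj_permutes[OF i]] by simp
  qed
  thus "pairing k (adj i \<circ> f) (adj i \<circ> g) (tau i v) = - pairing k f g v"
    by (simp add: tau_def pairing_sum pairing_scale sum_negf pairing_def[of k f g v])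
qed

subsection \<open>Separation of points\<close>

text \<open>A leading-term argument: for \<open>\<pi>\<close> in the support with the largest total
  span \<open>h\<close>, the functional of its minima and maxima kills every other partition of the
  support and reads off the coefficient of \<open>\<pi>\<close>. Without singletons no minimum is a
  maximum, so this functional is admissible.\<close>

lemma pairing_separates:
  assumes v: "Poly_Mapping.keys v \<subseteq> NC n \<inter> singleton_free n k"
    and zero: "\<And>f g. (\<And>s t. s < k \<Longrightarrow> t < k \<Longrightarrow> f s \<noteq> g t) \<Longrightarrow> pairing k f g v = 0"
  shows "v = 0"
proof (rule ccontr)
  assume "v \<noteq> 0"
  define h where "h = (\<lambda>\<pi>. \<Sum>B\<in>\<pi>. int (Max B) - int (Min B))"
  have "Poly_Mapping.keys v \<noteq> {}" using \<open>v \<noteq> 0\<close> by simp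
  then obtain \<pi> where \<pi>: "\<pi> \<in> Poly_Mapping.keys v"
    and max: "\<And>\<pi>'. \<pi>' \<in> Poly_Mapping.keys v \<Longrightarrow> h \<pi>' \<le> h \<pi>"
    using finite_has_maximal[of "h ` Poly_Mapping.keys v"] by force
  have NC: "\<pi>' \<in> NC n" "card \<pi>' = k" if "\<pi>' \<in> Poly_Mapping.keys v" for \<pi>'
    using v that by (auto simp: singleton_free_def)
  have part: "partition_on {1..n} \<pi>" using NC(1)[OF \<pi>] by (simp add: NC_def)
  have bl: "finite B" "B \<noteq> {}" "B \<subseteq> {1..n}" if "B \<in> \<pi>" for B
    using partition_block_finite[OF part _ that] by auto
  obtain Bs where Bs: "set Bs = \<pi>" "distinct Bs"
    using finite_distinct_list[OF finite_elements[OF _ part]] by auto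
  have len: "length Bs = k" using Bs NC(2)[OF \<pi>] distinct_card by fastforce
  define f where "f = (\<lambda>s. Min (Bs ! s))"
  define g where "g = (\<lambda>s. Max (Bs ! s))"
  have nth: "Bs ! s \<in> \<pi>" if "s < k" for s using that len Bs by auto
  have f: "f s \<in> Bs ! s" and g: "g s \<in> Bs ! s" if "s < k" for s
    using bl nth[OF that] by (auto simp: f_def g_def)
  have same: "s = t" if "s < k" "t < k" "x \<in> Bs ! s" "x \<in> Bs ! t" for s t x
    using that partition_on_same_block[OF part] nth Bs len nth_eq_iff_index_eq by metis
  have fg: "f s \<noteq> g t" if "s < k" "t < k" for s t
  proof
    assume eq: "f s = g t"
    hence "s = t" using same[OF that] f[OF that(1)] g[OF that(2)] by simp
    hence "Min (Bs ! s) = Max (Bs ! s)" using eq by (simp add: f_def g_def)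
    hence "Bs ! s = {f s}"
      using bl[OF nth[OF that(1)]] f[OF that(1)] unfolding f_def
      by (metis Max_ge Min_le antisym is_singletonI' is_singleton_the_elem singletonD)
    hence "{f s} \<in> \<pi>" using nth[OF that(1)] by simp
    thus False using v \<pi> by (auto simp: singleton_free_def)
  qed
  \<comment> \<open>\<open>f s\<close> and \<open>g t\<close> lie in the blocks
    \<open>Bs ! s\<close> and \<open>Bs ! t\<close>, so they share a block only on the
    diagonal.\<close>
  have "mat k k (\<lambda>(s, t). of_bool (\<exists>B\<in>\<pi>. f s \<in> B \<and> g t \<in> B)) = (1\<^sub>m k :: rat mat)"
  proof (rule eq_matI)
    fix s t assume "s < dim_row (1\<^sub>m k :: rat mat)" "t < dim_col (1\<^sub>m k :: rat mat)"
    hence st: "s < k" "t < k" by auto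
    have "(\<exists>B\<in>\<pi>. f s \<in> B \<and> g t \<in> B) \<longleftrightarrow> s = t"
      using f[OF st(1)] g[OF st(2)] nth st same partition_on_same_block[OF part] by metis
    thus "mat k k (\<lambda>(s, t). of_bool (\<exists>B\<in>\<pi>. f s \<in> B \<and> g t \<in> B)) $$ (s, t) = (1\<^sub>m k :: rat mat) $$ (s, t)"
      using st by simp
  qed auto
  hence one: "transversal_det k f g \<pi> = 1" by (simp add: transversal_det_def)
  have "transversal_det k f g \<pi>' = 0" if "\<pi>' \<in> Poly_Mapping.keys v" "\<pi>' \<noteq> \<pi>" for \<pi>'
    using transversal_det_Min_Max[OF NC[OF \<pi>] NC[OF that(1)] Bs] max[OF that(1)] that(2)
    unfolding f_def g_def h_def by blast
  hence "pairing k f g v = (\<Sum>\<pi>'\<in>Poly_Mapping.keys v. if \<pi>' = \<pi> then Poly_Mapping.lookup v \<pi> else 0)"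
    unfolding pairing_def using one by (intro sum.cong) auto
  also have "\<dots> = Poly_Mapping.lookup v \<pi>" using \<pi> by simp
  finally show False using zero[OF fg] \<pi> by (simp add: in_keys_iff)
qed

subsection \<open>The long cycle\<close>

lemma long_cycle_1: "long_cycle 1 = id"
  by (simp add: long_cycle_def)

text \<open>The right factor acts first: \<open>m\<close> goes to \<open>Suc m\<close>, which
  \<open>long_cycle m\<close> fixes, and \<open>Suc m\<close> goes to \<open>m\<close> and then to
  1. Iteration gives the factorisation into \<open>s_1, ..., s_(n-1)\<close>.\<close>

lemma long_cycle_Suc:
  assumes "m > 0"
  shows "long_cycle (Suc m) = long_cycle m \<circ> adj m"
proof
  fix x
  have outside: "long_cycle l x = x" if "x \<notin> {1..l}" for l x
    using permutes_not_in[OF long_cycle_permutes that] .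
  consider "x \<in> {1..<m}" | "x = m" | "x = Suc m" | "x \<notin> {1..Suc m}" using assms by fastforce
  thus "long_cycle (Suc m) x = (long_cycle m \<circ> adj m) x"
  proof cases
    case 1
    thus ?thesis by (simp add: adj_def Transposition.transpose_def long_cycle_apply)
  next
    case 2
    thus ?thesis using assms outside[of "Suc m" m] by (simp add: adj_def long_cycle_apply Suc_le_eq)
  next
    case 3
    thus ?thesis using assms by (simp add: adj_def long_cycle_apply Suc_le_eq)
  next
    case 4
    thus ?thesis using assms outside[of x m] outside[of x "Suc m"]
      by (auto simp: adj_def Transposition.transpose_def)
  qed
qed

text \<open>Each of the \<open>m - 1\<close> factors contributes a sign, and \<open>m + 1\<close>
  has the same parity. Since \<open>s_m\<close> acts first, the induction must allow
  \<open>v\<close>, \<open>f\<close> and \<open>g\<close> to vary.\<close>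

lemma skein_action_long_cycle:
  assumes \<rho>: "skein_action n \<rho>"
    and v: "Poly_Mapping.keys v \<subseteq> NC n \<inter> singleton_free n k"
    and m: "0 < m" "m \<le> n"
  shows "Poly_Mapping.keys (\<rho> (long_cycle m) v) \<subseteq> NC n \<inter> singleton_free n k"
    and "(\<And>s t. s < k \<Longrightarrow> t < k \<Longrightarrow> f s \<noteq> g t) \<Longrightarrow>
      pairing k (long_cycle m \<circ> f) (long_cycle m \<circ> g) (\<rho> (long_cycle m) v) =
        (- 1) ^ (m + 1) * pairing k f g v"
proof -
  interpret group_action "sym_group n" "V n" \<rho> using \<rho> by (simp add: skein_action_def)
  have "Poly_Mapping.keys (\<rho> (long_cycle m) v) \<subseteq> NC n \<inter> singleton_free n k \<and>
    ((\<forall>s<k. \<forall>t<k. f s \<noteq> g t) \<longrightarrow>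
      pairing k (long_cycle m \<circ> f) (long_cycle m \<circ> g) (\<rho> (long_cycle m) v) =
        (- 1) ^ (m + 1) * pairing k f g v)"
    using m v
  proof (induction m arbitrary: v f g rule: nat_induct_non_zero)
    case 1
    hence "v \<in> V n" by (auto simp: V_def)
    hence "\<rho> id v = v" using fun_cong[OF id_eq_one, of v] by (simp add: sym_group_def)
    hence fixed: "\<rho> (long_cycle 1) v = v" by (simp only: long_cycle_1)
    show ?case using 1 unfolding fixed unfolding long_cycle_1 by simp
  next
    case (Suc m)
    have i: "m \<in> {1..<n}" using Suc by auto
    have vV: "v \<in> V n" using Suc.prems by (auto simp: V_def)
    have carrier: "long_cycle m \<in> carrier (sym_group n)" "adj m \<in> carrier (sym_group n)"
      using permutes_subset[OF long_cycle_permutes, of m "{1..n}"] i adj_permutes[OF i]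
      by (auto simp: sym_group_def)
    have tau: "\<rho> (adj m) v = tau m v" using \<rho> i vV by (simp add: skein_action_def)
    \<comment> \<open>The action supplies noncrossingness of the support;
      \<open>tau_singleton_free\<close> supplies the absence of singletons and the block
      count.\<close>
    have "tau m v \<in> V n" using element_image[OF carrier(2) vV tau] .
    hence keys: "Poly_Mapping.keys (tau m v) \<subseteq> NC n \<inter> singleton_free n k"
      using tau_singleton_free(1)[OF Suc.prems(2) i] by (simp add: V_def)
    have \<rho>_Suc: "\<rho> (long_cycle (Suc m)) v = \<rho> (long_cycle m) (tau m v)"
      using composition_rule[OF vV carrier] tau
      by (simp add: long_cycle_Suc[OF Suc.hyps(1)] sym_group_def)
    have "inj (adj m)" by (rule permutes_inj[OF adj_permutes[OF i]])
    hence neq: "\<forall>s<k. \<forall>t<k. (adj m \<circ> f) s \<noteq> (adj m \<circ> g) t"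
      if "\<forall>s<k. \<forall>t<k. f s \<noteq> g t"
      using that by (simp add: inj_eq)
    have "m \<le> n" using i by simp
    note IH = Suc.IH[OF this keys, of "adj m \<circ> f" "adj m \<circ> g"]
    show ?case
    proof (intro conjI impI)
      show "Poly_Mapping.keys (\<rho> (long_cycle (Suc m)) v) \<subseteq> NC n \<inter> singleton_free n k"
        using IH unfolding \<rho>_Suc by blast
      assume fg: "\<forall>s<k. \<forall>t<k. f s \<noteq> g t"
      have "pairing k (long_cycle m \<circ> (adj m \<circ> f)) (long_cycle m \<circ> (adj m \<circ> g))
          (\<rho> (long_cycle m) (tau m v)) =
          (- 1) ^ (m + 1) * pairing k (adj m \<circ> f) (adj m \<circ> g) (tau m v)"
        using IH neq[OF fg] by blast
      also have "pairing k (adj m \<circ> f) (adj m \<circ> g) (tau m v) = - pairing k f g v"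
        using tau_singleton_free(2)[OF Suc.prems(2) i, of f g] fg by blast
      also have "(- 1) ^ (m + 1) * - pairing k f g v = (- 1) ^ (Suc m + 1) * pairing k f g v"
        by simp
      finally show "pairing k (long_cycle (Suc m) \<circ> f) (long_cycle (Suc m) \<circ> g)
          (\<rho> (long_cycle (Suc m)) v) = (- 1) ^ (Suc m + 1) * pairing k f g v"
        unfolding \<rho>_Suc unfolding long_cycle_Suc[OF Suc.hyps(1)] comp_assoc .
    qed
  qed
  thus "Poly_Mapping.keys (\<rho> (long_cycle m) v) \<subseteq> NC n \<inter> singleton_free n k"
    and "(\<And>s t. s < k \<Longrightarrow> t < k \<Longrightarrow> f s \<noteq> g t) \<Longrightarrow>
      pairing k (long_cycle m \<circ> f) (long_cycle m \<circ> g) (\<rho> (long_cycle m) v) =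
        (- 1) ^ (m + 1) * pairing k f g v"
    by blast+
qed

theorem theorem6p4:
  fixes n k :: nat
    and \<rho> :: "(nat \<Rightarrow> nat) \<Rightarrow> partition_vec \<Rightarrow> partition_vec"
    and \<pi> :: set_partition
  assumes "n > 0" and "k > 0"
    and "skein_action n \<rho>"
    and "\<pi> \<in> NCks n k 0"
  shows "\<rho> (long_cycle n) (basis_vec \<pi>) = scale ((- 1) ^ (n + 1)) (basis_vec (rotation n \<pi>))"
proof -
  let ?c = "long_cycle n" and ?b = "scale ((- 1) ^ (n + 1)) (basis_vec (rotation n \<pi>))"
  define u where "u = \<rho> ?c (basis_vec \<pi>) - ?b"
  have \<pi>: "Poly_Mapping.keys (basis_vec \<pi>) \<subseteq> NC n \<inter> singleton_free n k"
    using assms(4) by (simp add: keys_basis_vec NCks_0)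
  have c: "?c permutes {1..n}" by (rule long_cycle_permutes)
  note act = skein_action_long_cycle[OF assms(3) \<pi> assms(1) order_refl]
  have "Poly_Mapping.keys ?b \<subseteq> NC n \<inter> singleton_free n k"
    using keys_scale[of _ "basis_vec (rotation n \<pi>)"] rotation_in_NCks[OF assms(4)]
    by (auto simp: keys_basis_vec NCks_0)
  hence "Poly_Mapping.keys u \<subseteq> NC n \<inter> singleton_free n k"
    unfolding u_def using act(1) by (intro order_trans[OF keys_diff] Un_least)
  moreover have "pairing k f g u = 0" if fg: "\<And>s t. s < k \<Longrightarrow> t < k \<Longrightarrow> f s \<noteq> g t" for f g
  proof -
    \<comment> \<open>Pulling back along the cycle writes an arbitrary admissible pair in the form
      to which \<open>act(2)\<close> applies.\<close>
    define f' where "f' = Hilbert_Choice.inv ?c \<circ> f"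
    define g' where "g' = Hilbert_Choice.inv ?c \<circ> g"
    have f: "f = ?c \<circ> f'" and g: "g = ?c \<circ> g'"
      by (simp_all add: f'_def g'_def fun_eq_iff permutes_inverses[OF c])
    have "f' s \<noteq> g' t" if "s < k" "t < k" for s t
      using fg[OF that] unfolding f g by auto
    hence "pairing k f g (\<rho> ?c (basis_vec \<pi>)) = (- 1) ^ (n + 1) * transversal_det k f' g' \<pi>"
      using act(2)[of f' g'] by (simp add: f g pairing_basis_vec)
    also have "transversal_det k f' g' \<pi> = transversal_det k f g (rotation n \<pi>)"
      using transversal_det_perm_image[OF c] by (simp add: f g rotation_def)
    finally show ?thesis
      by (simp add: u_def pairing_diff pairing_scale pairing_basis_vec)
  qed
  ultimately have "u = 0" by (rule pairing_separates)
  thus ?thesis by (simp add: u_def)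
qed

end
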